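(* Suppose there exist a constant $m>0$ and a diagonal matrix $R\in\mathbb R^{n\times n}$ with positive diagonal entries such that $\operatorname{Sym}(R\Theta^*\nabla\Phi(x))\succeq\frac12 m\,\mathbb I$ for all $x\in\mathcal X$. Then the response map $x^*(\cdot)$ is unique. Moreover, on the set $\mathcal P=-\Theta^*\Phi(\operatorname{int}\mathcal X)\subset\mathbb R^n$ there exists a diffeomorphism $$H:\mathcal P\to\operatorname{int}\mathcal X$$ such that $H(p)=x^*(p)$ for all $p\in\mathcal P$. In addition, for every $p\in\mathcal P$ and $w\in\mathbb R^n$, $$h_1\|w\|_2\le\|\nabla H(p)w\|_2\le h_2\|w\|_2\qquad\text{and}\qquad \Theta^*\Phi(H(p))+p=0,$$ where $h_1=\big(\max_{x\in\mathcal X}\|\nabla G_0(x)\|_2\big)^{-1}$ and $h_2=2\lambda_{\max}(R)/m$.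
   Context: There are $n$ agents. Agent $i\in[n]=\{1,\dots,n\}$ chooses $x_i\in\mathcal X_i$, with $\mathcal X_i\subset\mathbb R$ compact and convex; $\mathcal X=\prod_i\mathcal X_i$. For a fixed degree $d\in\mathbb N$, $\Phi:\mathbb R^n\to\mathbb R^D$, $D=\binom{n+d}{d}$, is the vector of all monomials $x^a=x_1^{a_1}\cdots x_n^{a_n}$, $a\in\mathbb N^n$, of total degree $a_1+\dots+a_n\le d$. Agent $i$'s nominal cost $\ell_i:\mathcal X\to\mathbb R$ satisfies $\frac{\partial\ell_i}{\partial x_i}(x)=\theta_i^{*\top}\Phi(x)$ with $\theta_i^*\in\mathbb R^D$, and $\Theta^*=(\theta_1^*,\dots,\theta_n^* )^\top\in\mathbb R^{n\times D}$. The pseudo-gradient is $G_0(x)=\Theta^*\Phi(x)$; $\nabla$ denotes the Jacobian, $\operatorname{Sym}(A)=\frac12(A+A^\top)$, and $\|\cdot\|_2$ is the Euclidean norm for vectors and the induced operator norm for matrices. Fix a desired profile $(x^\dagger,u^\dagger)\in\mathcal X\times\mathbb R^n$. For $p\in\mathbb R^n$ the incentive law is $\gamma_i(x,p)=p_ix_i+(u_i^\dagger-p_ix_i^\dagger)$, and agent $i$ minimizes $\ell_i(x)+\gamma_i(x,p)$ over $x_i\in\mathcal X_i$. A point $x\in\mathcal X$ is an Incentivized Nash Equilibrium (INE) for $p$ if for every $i$, $x_i$ minimizes $\ell_i(\cdot,x_{-i})+\gamma_i((\cdot,x_{-i}),p)$ over $\mathcal X_i$. A response map is a map $x^*:\mathbb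 R^n\to\mathcal X$ such that $x^*(p)$ is an INE for $p$, for every $p\in\mathbb R^n$. *)

theory Defs
  imports "HOL-Analysis.Analysis"
begin

text \<open>
  Exponent vectors are indexed by a finite type \<open>'k\<close>: the predicate says that \<open>e\<close> enumerates,
  without repetition, all exponents of total degree at most \<open>d\<close> in \<open>CARD('n)\<close> variables.
  It forces \<open>CARD('k) = (CARD('n) + d) choose d\<close>, so \<open>real ^ 'k\<close> plays the role of the
  space of coefficient vectors.
\<close>

definition monomial_enumeration :: "nat \<Rightarrow> ('k::finite \<Rightarrow> nat ^ 'n) \<Rightarrow> bool" where
  "monomial_enumeration d e \<longleftrightarrow> bij_betw e UNIV {a. (\<Sum>i\<in>UNIV. a $ i) \<le> d}"

definition monomial_vec :: "('k::finite \<Rightarrow> nat ^ 'n) \<Rightarrow> real ^ 'n \<Rightarrow> real ^ 'k" where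
  "monomial_vec e x = (\<chi> k. \<Prod>i\<in>UNIV. x $ i ^ (e k $ i))"

definition profiles :: "('n::finite \<Rightarrow> real set) \<Rightarrow> (real ^ 'n) set" where
  "profiles X = {x. \<forall>i. x $ i \<in> X i}"

definition deviate :: "real ^ 'n \<Rightarrow> 'n \<Rightarrow> real \<Rightarrow> real ^ 'n" where
  "deviate x i t = (\<chi> j. if j = i then t else x $ j)"

text \<open>
  The costs are only meant on the action profiles, so at boundary points the partial derivative
  is taken within the agent's own action set.
\<close>

definition partial_gradients ::
  "('n::finite \<Rightarrow> real set) \<Rightarrow> ('n \<Rightarrow> real ^ 'n \<Rightarrow> real) \<Rightarrow> (real ^ 'n \<Rightarrow> real ^ 'n) \<Rightarrow> bool" where
  "partial_gradients X \<l> G \<longleftrightarrow>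
     (\<forall>x\<in>profiles X. \<forall>i.
        ((\<lambda>t. \<l> i (deviate x i t)) has_real_derivative G x $ i) (at (x $ i) within X i))"

definition incentive :: "real ^ 'n \<Rightarrow> real ^ 'n \<Rightarrow> 'n \<Rightarrow> real ^ 'n \<Rightarrow> real ^ 'n \<Rightarrow> real" where
  "incentive xd ud i x p = p $ i * x $ i + (ud $ i - p $ i * xd $ i)"

definition is_INE ::
  "('n::finite \<Rightarrow> real set) \<Rightarrow> ('n \<Rightarrow> real ^ 'n \<Rightarrow> real) \<Rightarrow> real ^ 'n \<Rightarrow> real ^ 'n
     \<Rightarrow> real ^ 'n \<Rightarrow> real ^ 'n \<Rightarrow> bool" where
  "is_INE X \<l> xd ud p x \<longleftrightarrow> x \<in> profiles X \<and>
     (\<forall>i. is_arg_min (\<lambda>t. \<l> i (deviate x i t) + incentive xd ud i (deviate x i t) p)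
            (\<lambda>t. t \<in> X i) (x $ i))"

definition response_map ::
  "('n::finite \<Rightarrow> real set) \<Rightarrow> ('n \<Rightarrow> real ^ 'n \<Rightarrow> real) \<Rightarrow> real ^ 'n \<Rightarrow> real ^ 'n
     \<Rightarrow> (real ^ 'n \<Rightarrow> real ^ 'n) \<Rightarrow> bool" where
  "response_map X \<l> xd ud xs \<longleftrightarrow> (\<forall>p. is_INE X \<l> xd ud p (xs p))"

definition Sym :: "real ^ 'n ^ 'n \<Rightarrow> real ^ 'n ^ 'n" where
  "Sym A = (1 / 2) *\<^sub>R (A + transpose A)"

definition psd :: "real ^ 'n ^ 'n \<Rightarrow> bool" where
  "psd A \<longleftrightarrow> transpose A = A \<and> (\<forall>v. 0 \<le> v \<bullet> (A *v v))"

definition loewner_ge :: "real ^ 'n ^ 'n \<Rightarrow> real ^ 'n ^ 'n \<Rightarrow> bool"  (infix "\<succeq>" 50) where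
  "A \<succeq> B \<longleftrightarrow> psd (A - B)"

definition diagonal_matrix :: "real ^ 'n ^ 'n \<Rightarrow> bool" where
  "diagonal_matrix A \<longleftrightarrow> (\<forall>i j. i \<noteq> j \<longrightarrow> A $ i $ j = 0)"

definition lambda_max :: "real ^ 'n ^ 'n \<Rightarrow> real" where
  "lambda_max A = Max {c. \<exists>v. v \<noteq> 0 \<and> A *v v = c *\<^sub>R v}"

definition op_norm :: "real ^ 'n ^ 'm \<Rightarrow> real" where
  "op_norm A = onorm (\<lambda>v. A *v v)"

text \<open>
  \<open>C_k k S f\<close>: \<open>f\<close> is \<open>k\<close> times continuously differentiable on the open set \<open>S\<close>
  (for finite-dimensional domains, to which it is applied), expressed through the directional
  derivatives of the total derivative.
\<close>

primrec C_k ::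
  "nat \<Rightarrow> 'a::euclidean_space set \<Rightarrow> ('a \<Rightarrow> 'b::real_normed_vector) \<Rightarrow> bool" where
  "C_k 0 S f \<longleftrightarrow> continuous_on S f"
| "C_k (Suc k) S f \<longleftrightarrow>
     (\<forall>x\<in>S. f differentiable (at x)) \<and> (\<forall>v. C_k k S (\<lambda>x. frechet_derivative f (at x) v))"

definition smooth_on :: "'a::euclidean_space set \<Rightarrow> ('a \<Rightarrow> 'b::real_normed_vector) \<Rightarrow> bool" where
  "smooth_on S f \<longleftrightarrow> (\<forall>k. C_k k S f)"

definition diffeomorphism ::
  "'a::euclidean_space set \<Rightarrow> 'b::euclidean_space set \<Rightarrow> ('a \<Rightarrow> 'b) \<Rightarrow> bool" where
  "diffeomorphism S T f \<longleftrightarrow>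
     open S \<and> open T \<and> bij_betw f S T \<and> smooth_on S f \<and> smooth_on T (inv_into S f)"

end

theory Submission
  imports Defs
begin

text \<open>
  Write \<open>G\<close> for the pseudo-gradient. Two consequences of the hypothesis on \<open>R\<close> carry the proof.

  Integrated along segments of the convex set of profiles, the lower bound on the symmetric part of
  the weighted Jacobian \<open>R \<nabla>G\<close> becomes strong monotonicity of \<open>R G\<close>
  (\<open>strongly_monotone_of_derivative\<close>). Because \<open>R\<close> is diagonal with positive entries, it only
  rescales each agent's marginal cost: varying one coordinate shows that every agent's cost is
  convex in the agent's own action, so that equilibria are exactly the solutions of the
  first-order conditions \<open>0 \<le> (G x + p)\<^sub>i (t - x\<^sub>i)\<close> for all \<open>i\<close> and \<open>t\<close>
  (\<open>is_INE_iff_stationary\<close>). A solution is a fixed point of the projected gradient step, which exists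
  by Brouwer (\<open>stationary_exists\<close>), and two solutions coincide: adding their conditions with the
  weights \<open>R\<^sub>i\<^sub>i\<close> contradicts strict monotonicity (\<open>stationary_unique\<close>).

  Taken pointwise, the bound makes \<open>\<nabla>G x\<close> invertible. If \<open>x\<close> is an interior profile and
  \<open>p = - G x\<close>, the first-order conditions hold trivially at \<open>x\<close>, hence \<open>x\<close> is the equilibrium for
  \<open>p\<close>. The response map is therefore a left inverse of \<open>- G\<close> on the interior and itself serves as
  \<open>H\<close>; invariance of domain makes its domain open, and a smooth map with invertible Jacobian has a
  smooth inverse (\<open>diffeomorphism_of_smooth_inverse\<close>). With \<open>u = \<nabla>H(p) w\<close>, that is
  \<open>\<nabla>G u = - w\<close>, the bound \<open>norm w \<le> op_norm (\<nabla>G) * norm u\<close> gives \<open>h\<^sub>1\<close>, and testing the quadratic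
  form of \<open>R \<nabla>G\<close> with \<open>u\<close> gives \<open>h\<^sub>2\<close>.
\<close>

section \<open>Calculus of continuously differentiable functions\<close>

text \<open>
  The derivative at a point of an open set sees only values nearby. The closure properties below
  identify the derivative by a formula valid on \<open>S\<close> alone, and this lemma is what lets that
  formula stand in for the derivative.
\<close>

lemma C_k_cong:
  assumes "open S" and "\<And>x. x \<in> S \<Longrightarrow> f x = g x" and "C_k k S f"
  shows "C_k k S g"
  using assms(2,3)
proof (induction k arbitrary: f g)
  case 0
  then show ?case
    by (simp cong: continuous_on_cong)
next
  case (Suc k)
  have der: "(g has_derivative frechet_derivative f (at x)) (at x)" if "x \<in> S" for x
  proof -
    have "(f has_derivative frechet_derivative f (at x)) (at x)"
      using Suc.prems(2) that by (simp add: frechet_derivative_works)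
    then show ?thesis
      using has_derivative_transform_within_open \<open>open S\<close> that Suc.prems(1) by blast
  qed
  then have "frechet_derivative g (at x) = frechet_derivative f (at x)" if "x \<in> S" for x
    using that frechet_derivative_at by metis
  moreover have "C_k k S (\<lambda>x. frechet_derivative f (at x) v)" for v
    using Suc.prems(2) by simp
  ultimately have "C_k k S (\<lambda>x. frechet_derivative g (at x) v)" for v
    using Suc.IH[of "\<lambda>x. frechet_derivative f (at x) v"] by simp
  then show ?case
    using der by (auto simp: differentiable_def)
qed

lemma C_k_SucI:
  assumes "open S" and "\<And>x. x \<in> S \<Longrightarrow> (f has_derivative f' x) (at x)"
    and "\<And>v. C_k k S (\<lambda>x. f' x v)"
  shows "C_k (Suc k) S f"
proof -
  have "f' x = frechet_derivative f (at x)" if "x \<in> S" for x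
    using assms(2) that by (simp add: frechet_derivative_at)
  then have "C_k k S (\<lambda>x. frechet_derivative f (at x) v)" for v
    using C_k_cong[OF \<open>open S\<close> _ assms(3)[of v]] by simp
  then show ?thesis
    using assms(2) by (auto simp: differentiable_def)
qed

lemma C_k_SucD:
  assumes "C_k (Suc k) S f"
  shows "\<And>x. x \<in> S \<Longrightarrow> (f has_derivative frechet_derivative f (at x)) (at x)"
    and "C_k k S (\<lambda>x. frechet_derivative f (at x) v)"
  using assms by (simp_all add: frechet_derivative_works)

lemma C_k_Suc_imp: "C_k (Suc k) S f \<Longrightarrow> C_k k S f"
proof (induction k arbitrary: f)
  case 0
  then show ?case
    by (auto intro!: continuous_at_imp_continuous_on dest: differentiable_imp_continuous_within)
next
  case (Suc k)
  have "C_k k S (\<lambda>x. frechet_derivative f (at x) v)" for v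
    using Suc.IH[OF C_k_SucD(2)[OF Suc.prems]] .
  then show ?case
    using Suc.prems by simp
qed

lemma C_k_imp_continuous_on: "C_k k S f \<Longrightarrow> continuous_on S f"
  by (induction k) (use C_k_Suc_imp in auto)

lemma C_k_subset: "C_k k S f \<Longrightarrow> T \<subseteq> S \<Longrightarrow> C_k k T f"
proof (induction k arbitrary: f)
  case 0
  then show ?case by (auto intro: continuous_on_subset)
qed auto

lemma C_k_const: "C_k k S (\<lambda>x. c)"
  by (induction k arbitrary: c) simp_all

lemma C_k_bounded_linear:
  assumes "bounded_linear h" and "open S"
  shows "C_k k S h"
proof (cases k)
  case 0
  then show ?thesis
    using assms(1) by (simp add: linear_continuous_on)
next
  case (Suc k')
  have "C_k (Suc k') S h"
    by (rule C_k_SucI[OF \<open>open S\<close>])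
      (use assms(1) bounded_linear_imp_has_derivative C_k_const in auto)
  then show ?thesis
    using Suc by simp
qed

lemma C_k_bounded_linear_compose:
  assumes "bounded_linear h" and "open S" and "C_k k S f"
  shows "C_k k S (\<lambda>x. h (f x))"
  using assms(3)
proof (induction k arbitrary: f)
  case 0
  then show ?case
    using bounded_linear.continuous_on[OF assms(1)] by simp
next
  case (Suc k)
  show ?case
  proof (rule C_k_SucI[OF \<open>open S\<close>])
    show "((\<lambda>x. h (f x)) has_derivative (\<lambda>v. h (frechet_derivative f (at x) v))) (at x)"
      if "x \<in> S" for x
      using bounded_linear.has_derivative[OF assms(1) C_k_SucD(1)[OF Suc.prems that]] .
    show "C_k k S (\<lambda>x. h (frechet_derivative f (at x) v))" for v
      using Suc.IH[OF C_k_SucD(2)[OF Suc.prems]] .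
  qed
qed

lemma C_k_add:
  assumes "open S" and "C_k k S f" and "C_k k S g"
  shows "C_k k S (\<lambda>x. f x + g x)"
  using assms(2,3)
proof (induction k arbitrary: f g)
  case 0
  then show ?case
    by (simp add: continuous_on_add)
next
  case (Suc k)
  show ?case
  proof (rule C_k_SucI[OF \<open>open S\<close>])
    show "((\<lambda>x. f x + g x) has_derivative
        (\<lambda>v. frechet_derivative f (at x) v + frechet_derivative g (at x) v)) (at x)"
      if "x \<in> S" for x
      using has_derivative_add C_k_SucD(1)[OF Suc.prems(1) that] C_k_SucD(1)[OF Suc.prems(2) that]
      by blast
    show "C_k k S (\<lambda>x. frechet_derivative f (at x) v + frechet_derivative g (at x) v)" for v
      using Suc.IH[OF C_k_SucD(2)[OF Suc.prems(1)] C_k_SucD(2)[OF Suc.prems(2)]] .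
  qed
qed

text \<open>
  The product rule expresses the derivative by two products of the same bilinear kind, in which one
  factor has lost one order of differentiability; so the induction needs \<open>C_k_Suc_imp\<close> for the
  other factor.
\<close>

lemma C_k_bilinear:
  assumes "bounded_bilinear h" and "open S" and "C_k k S f" and "C_k k S g"
  shows "C_k k S (\<lambda>x. h (f x) (g x))"
  using assms(3,4)
proof (induction k arbitrary: f g)
  case 0
  then show ?case
    using bounded_bilinear.continuous_on[OF assms(1)] by simp
next
  case (Suc k)
  show ?case
  proof (rule C_k_SucI[OF \<open>open S\<close>])
    show "((\<lambda>x. h (f x) (g x)) has_derivative
        (\<lambda>v. h (f x) (frechet_derivative g (at x) v) +
             h (frechet_derivative f (at x) v) (g x))) (at x)"
      if "x \<in> S" for x
      using bounded_bilinear.FDERIV[OF assms(1)] C_k_SucD(1)[OF Suc.prems(1) that]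
        C_k_SucD(1)[OF Suc.prems(2) that]
      by blast
    show "C_k k S (\<lambda>x. h (f x) (frechet_derivative g (at x) v) +
        h (frechet_derivative f (at x) v) (g x))" for v
      by (intro C_k_add \<open>open S\<close> Suc.IH C_k_Suc_imp[OF Suc.prems(1)] C_k_Suc_imp[OF Suc.prems(2)]
          C_k_SucD(2)[OF Suc.prems(1)] C_k_SucD(2)[OF Suc.prems(2)])
  qed
qed

lemmas C_k_mult = C_k_bilinear[OF bounded_bilinear_mult]
lemmas C_k_scaleR = C_k_bilinear[OF bounded_bilinear_scaleR]

lemma C_k_sum:
  assumes "open S" and "\<And>i. i \<in> I \<Longrightarrow> C_k k S (f i)"
  shows "C_k k S (\<lambda>x. \<Sum>i\<in>I. f i x)"
  using assms(2)
  by (induction I rule: infinite_finite_induct) (simp_all add: C_k_const C_k_add \<open>open S\<close>)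

lemma C_k_prod:
  fixes f :: "'i \<Rightarrow> 'a::euclidean_space \<Rightarrow> real"
  assumes "open S" and "\<And>i. i \<in> I \<Longrightarrow> C_k k S (f i)"
  shows "C_k k S (\<lambda>x. \<Prod>i\<in>I. f i x)"
  using assms(2)
  by (induction I rule: infinite_finite_induct) (simp_all add: C_k_const C_k_mult \<open>open S\<close>)

lemma C_k_power:
  fixes f :: "'a::euclidean_space \<Rightarrow> real"
  assumes "open S" and "C_k k S f"
  shows "C_k k S (\<lambda>x. f x ^ n)"
  by (induction n) (simp_all add: C_k_const C_k_mult assms)

lemma C_k_vec_nth:
  assumes "open S" and "C_k k S f"
  shows "C_k k S (\<lambda>x. f x $ i)"
  using C_k_bounded_linear_compose[OF bounded_linear_vec_nth assms] .

lemma C_k_vecI: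
  fixes f :: "'a::euclidean_space \<Rightarrow> real ^ 'n"
  assumes "open S" and "\<And>i. C_k k S (\<lambda>x. f x $ i)"
  shows "C_k k S f"
proof -
  have "C_k k S (\<lambda>x. \<Sum>i\<in>UNIV. (f x $ i) *\<^sub>R axis i (1::real))"
    by (intro C_k_sum C_k_bounded_linear_compose[OF bounded_linear_scaleR_left] assms)
  then show ?thesis
    using basis_expansion[of "f _"] by (simp add: scalar_mult_eq_scaleR)
qed

lemma C_k_inverse:
  fixes f :: "'a::euclidean_space \<Rightarrow> real"
  assumes "open S" and "C_k k S f" and "\<And>x. x \<in> S \<Longrightarrow> f x \<noteq> 0"
  shows "C_k k S (\<lambda>x. inverse (f x))"
  using assms(2)
proof (induction k)
  case 0
  then show ?case
    using assms(3) by (simp add: continuous_on_inverse)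
next
  case (Suc k)
  show ?case
  proof (rule C_k_SucI[OF \<open>open S\<close>])
    show "((\<lambda>x. inverse (f x)) has_derivative
        (\<lambda>v. (- 1) * (inverse (f x) * frechet_derivative f (at x) v * inverse (f x)))) (at x)"
      if "x \<in> S" for x
      using Deriv.has_derivative_inverse[OF assms(3)[OF that] C_k_SucD(1)[OF Suc.prems that]] by simp
    show "C_k k S (\<lambda>x. (- 1) * (inverse (f x) * frechet_derivative f (at x) v * inverse (f x)))" for v
      by (intro C_k_mult C_k_const \<open>open S\<close> C_k_SucD(2)[OF Suc.prems] Suc.IH[OF C_k_Suc_imp[OF Suc.prems]])
  qed
qed

text \<open>
  The chain rule yields \<open>g' (f x) (f' x v)\<close>, where the direction itself depends on \<open>x\<close>. Expanding
  the direction in the basis turns this into a sum of products of a scalar function with a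
  composition \<open>g' (f x) b\<close> in a fixed direction, to which the induction hypothesis applies.
\<close>

lemma C_k_compose:
  fixes g :: "'b::euclidean_space \<Rightarrow> 'c::real_normed_vector"
  assumes "open S" and "f ` S \<subseteq> T" and "C_k k S f" and "C_k k T g"
  shows "C_k k S (\<lambda>x. g (f x))"
  using assms(3,4)
proof (induction k arbitrary: g)
  case 0
  then show ?case
    using continuous_on_compose2 assms(2) by auto
next
  case (Suc k)
  let ?f' = "\<lambda>x. frechet_derivative f (at x)" and ?g' = "\<lambda>y. frechet_derivative g (at y)"
  have fx: "f x \<in> T" if "x \<in> S" for x
    using that assms(2) by auto
  show ?case
  proof (rule C_k_SucI[OF \<open>open S\<close>])
    fix x assume "x \<in> S"
    have g': "(g has_derivative ?g' (f x)) (at (f x))"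
      using C_k_SucD(1)[OF Suc.prems(2) fx] \<open>x \<in> S\<close> .
    have "?g' (f x) (?f' x v) = (\<Sum>b\<in>Basis. (?f' x v \<bullet> b) *\<^sub>R ?g' (f x) b)" for v
    proof -
      interpret linear "?g' (f x)"
        using has_derivative_linear[OF g'] .
      have "?g' (f x) (?f' x v) = ?g' (f x) (\<Sum>b\<in>Basis. (?f' x v \<bullet> b) *\<^sub>R b)"
        by (simp add: euclidean_representation)
      then show ?thesis
        by (simp add: sum scaleR)
    qed
    then show "((\<lambda>x. g (f x)) has_derivative
        (\<lambda>v. \<Sum>b\<in>Basis. (?f' x v \<bullet> b) *\<^sub>R ?g' (f x) b)) (at x)"
      using has_derivative_compose[OF C_k_SucD(1)[OF Suc.prems(1) \<open>x \<in> S\<close>] g'] by simp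
  next
    fix v
    show "C_k k S (\<lambda>x. \<Sum>b\<in>Basis. (?f' x v \<bullet> b) *\<^sub>R ?g' (f x) b)"
      by (intro C_k_sum C_k_scaleR \<open>open S\<close> Suc.IH C_k_Suc_imp[OF Suc.prems(1)]
          C_k_bounded_linear_compose[OF bounded_linear_inner_left] C_k_SucD(2)[OF Suc.prems(1)]
          C_k_SucD(2)[OF Suc.prems(2)])
  qed
qed

lemma C_k_monomial_vec:
  assumes "open S"
  shows "C_k k S (monomial_vec e)"
proof (rule C_k_vecI[OF assms])
  fix i
  have "C_k k S (\<lambda>x. \<Prod>j\<in>UNIV. x $ j ^ (e i $ j))"
    by (intro C_k_prod C_k_power C_k_bounded_linear assms bounded_linear_vec_nth)
  then show "C_k k S (\<lambda>x. monomial_vec e x $ i)"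
    by (simp add: monomial_vec_def)
qed

section \<open>Smooth inverse functions\<close>

lemma C_k_det:
  fixes A :: "'a::euclidean_space \<Rightarrow> real ^ 'n ^ 'n"
  assumes "open S" and "\<And>i j. C_k k S (\<lambda>x. A x $ i $ j)"
  shows "C_k k S (\<lambda>x. det (A x))"
  unfolding det_def by (intro C_k_sum C_k_mult C_k_prod C_k_const assms)

lemma matrix_inv_mult_right:
  fixes A :: "real ^ 'n ^ 'n"
  assumes "invertible A"
  shows "A *v (matrix_inv A *v v) = v"
  using someI_ex[OF assms[unfolded invertible_def]]
  by (simp add: matrix_inv_def matrix_vector_mul_assoc)

text \<open>
  By Cramer's rule the entries of the solution are quotients of determinants, which are polynomials
  in the entries of the matrix and of \<open>v\<close>.
\<close>

lemma C_k_matrix_inv_mult: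
  fixes A :: "'a::euclidean_space \<Rightarrow> real ^ 'n ^ 'n"
  assumes "open S" and "\<And>i j. C_k k S (\<lambda>x. A x $ i $ j)" and "\<And>x. x \<in> S \<Longrightarrow> invertible (A x)"
  shows "C_k k S (\<lambda>x. matrix_inv (A x) *v v)"
proof (rule C_k_vecI[OF \<open>open S\<close>])
  fix i
  have det: "det (A x) \<noteq> 0" if "x \<in> S" for x
    using assms(3) that invertible_det_nz by blast
  have cram: "det (\<chi> r c. if c = i then v $ r else A x $ r $ c) * inverse (det (A x))
      = (matrix_inv (A x) *v v) $ i" if "x \<in> S" for x
  proof -
    have "matrix_inv (A x) *v v =
        (\<chi> k. det (\<chi> r c. if c = k then v $ r else A x $ r $ c) / det (A x))"
      using cramer[OF det[OF that]] matrix_inv_mult_right[OF assms(3)[OF that]] by blast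
    then show ?thesis
      by (simp add: divide_inverse)
  qed
  have "C_k k S (\<lambda>x. if c = i then v $ r else A x $ r $ c)" for r c
    by (cases "c = i") (simp_all add: assms(2) C_k_const)
  then have numer: "C_k k S (\<lambda>x. det (\<chi> r c. if c = i then v $ r else A x $ r $ c) * inverse (det (A x)))"
    by (intro C_k_mult C_k_det C_k_inverse det \<open>open S\<close> assms(2)) simp_all
  show "C_k k S (\<lambda>x. (matrix_inv (A x) *v v) $ i)"
    by (rule C_k_cong[OF \<open>open S\<close> _ numer]) (erule cram)
qed

lemma has_derivative_left_inverse:
  fixes F g :: "real ^ 'n \<Rightarrow> real ^ 'n"
  assumes "open U" and "\<And>x. x \<in> U \<Longrightarrow> F differentiable (at x)"
    and "\<And>x. x \<in> U \<Longrightarrow> invertible (jacobian F (at x))"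
    and "\<And>x. x \<in> U \<Longrightarrow> g (F x) = x" and "x \<in> U"
  shows "(g has_derivative (\<lambda>w. matrix_inv (jacobian F (at x)) *v w)) (at (F x))"
proof (rule has_derivative_inverse_strong[OF assms(1,5)])
  show "continuous_on U F"
    using assms(2) by (auto intro!: continuous_at_imp_continuous_on dest: differentiable_imp_continuous_within)
  show "(F has_derivative (\<lambda>h. jacobian F (at x) *v h)) (at x)"
    using assms(2,5) jacobian_works by blast
  show "g (F x) = x" if "x \<in> U" for x
    using assms(4) that .
  show "(\<lambda>h. jacobian F (at x) *v h) \<circ> (\<lambda>w. matrix_inv (jacobian F (at x)) *v w) = id"
    using matrix_inv_mult_right[OF assms(3)[OF assms(5)]] by (auto simp: fun_eq_iff)
qed

lemma jacobian_entry:
  "jacobian f (at x) $ i $ j = frechet_derivative f (at x) (axis j 1) $ i"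
  by (simp add: jacobian_def matrix_def)

text \<open>
  The differentiability order of \<open>g\<close> is bootstrapped: the derivative of \<open>g\<close> in direction \<open>v\<close> is
  the smooth function \<open>\<lambda>x. matrix_inv (jacobian F (at x)) *v v\<close> composed with \<open>g\<close>, so it is as
  often differentiable as \<open>g\<close>, and \<open>g\<close> once more.
\<close>

lemma diffeomorphism_of_smooth_inverse:
  fixes F g :: "real ^ 'n \<Rightarrow> real ^ 'n"
  assumes "open U" and "smooth_on U F"
    and "\<And>x. x \<in> U \<Longrightarrow> invertible (jacobian F (at x))"
    and gF: "\<And>x. x \<in> U \<Longrightarrow> g (F x) = x"
  shows "diffeomorphism (F ` U) U g"
proof -
  have Ck: "C_k k U F" for k
    using assms(2) by (simp add: smooth_on_def)
  have diff: "F differentiable (at x)" if "x \<in> U" for x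
    using Ck[of 1] that by simp
  have inj: "inj_on F U"
    using gF by (rule inj_on_inverseI)
  have opn: "open (F ` U)"
    using invariance_of_domain[OF _ \<open>open U\<close> inj] Ck[of 0] by simp
  have "C_k k (F ` U) g" for k
  proof (induction k)
    case 0
    have "(g has_derivative (\<lambda>w. matrix_inv (jacobian F (at x)) *v w)) (at (F x))" if "x \<in> U" for x
      using has_derivative_left_inverse[OF assms(1) diff assms(3,4) that] by simp
    then show ?case
      by (auto intro!: continuous_at_imp_continuous_on dest: has_derivative_continuous)
  next
    case (Suc k)
    show ?case
    proof (rule C_k_SucI[OF opn])
      show "(g has_derivative (\<lambda>w. matrix_inv (jacobian F (at (g y))) *v w)) (at y)"
        if "y \<in> F ` U" for y
        using has_derivative_left_inverse[OF assms(1) diff assms(3,4)] that gF by auto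
      have "C_k k U (\<lambda>x. matrix_inv (jacobian F (at x)) *v v)" for v
        using assms(1,3) C_k_vec_nth[OF \<open>open U\<close> C_k_SucD(2)[OF Ck]]
        by (intro C_k_matrix_inv_mult) (simp_all add: jacobian_entry)
      then show "C_k k (F ` U) (\<lambda>y. matrix_inv (jacobian F (at (g y))) *v v)" for v
        by (intro C_k_compose[where T = U, OF opn _ Suc.IH]) (auto simp: gF)
    qed
  qed
  moreover have "bij_betw g (F ` U) U"
    using gF by (auto simp: bij_betw_def inj_on_def image_image)
  moreover have "C_k k U (inv_into (F ` U) g)" for k
  proof (rule C_k_cong[OF \<open>open U\<close> _ Ck])
    show "F x = inv_into (F ` U) g x" if "x \<in> U" for x
      using \<open>bij_betw g (F ` U) U\<close> that gF by (metis bij_betw_imp_inj_on imageI inv_into_f_f)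
  qed
  ultimately show ?thesis
    using opn \<open>open U\<close> by (simp add: diffeomorphism_def smooth_on_def)
qed

section \<open>Monotonicity and first-order conditions\<close>

text \<open>
  The mean value theorem is applied to \<open>\<lambda>t. (x - y) \<bullet> F (y + t *\<^sub>R (x - y))\<close> on the unit interval.
\<close>

lemma strongly_monotone_of_derivative:
  fixes F :: "'a::real_inner \<Rightarrow> 'a"
  assumes "convex S" and "\<And>x. x \<in> S \<Longrightarrow> (F has_derivative F' x) (at x)"
    and "\<And>x v. x \<in> S \<Longrightarrow> c * (norm v)\<^sup>2 \<le> v \<bullet> F' x v"
    and "x \<in> S" and "y \<in> S"
  shows "c * (norm (x - y))\<^sup>2 \<le> (x - y) \<bullet> (F x - F y)"
proof -
  define z where "z t = y + t *\<^sub>R (x - y)" for t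
  have zS: "z t \<in> S" if "0 \<le> t" "t \<le> 1" for t
    using convexD_alt[OF assms(1) assms(5,4) that] by (simp add: z_def algebra_simps)
  have "((\<lambda>t. (x - y) \<bullet> F (z t)) has_derivative (\<lambda>s. (x - y) \<bullet> F' (z t) (s *\<^sub>R (x - y))))
      (at t within {0..1})" if "0 \<le> t" "t \<le> 1" for t
  proof -
    have "(z has_derivative (\<lambda>s. s *\<^sub>R (x - y))) (at t within {0..1})"
      unfolding z_def by (auto intro!: derivative_eq_intros)
    from has_derivative_compose[OF this assms(2)[OF zS[OF that]]] show ?thesis
      by (rule has_derivative_inner_right)
  qed
  from mvt_very_simple[OF zero_le_one this] obtain t where t: "0 \<le> t" "t \<le> 1"
    and eq: "(x - y) \<bullet> F (z 1) - (x - y) \<bullet> F (z 0) = (x - y) \<bullet> F' (z t) ((1 - 0) *\<^sub>R (x - y))"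
    by auto
  then have "(x - y) \<bullet> (F x - F y) = (x - y) \<bullet> F' (z t) (x - y)"
    by (simp add: z_def inner_diff_right)
  then show ?thesis
    using assms(3)[OF zS[OF t]] by simp
qed

text \<open>
  A monotone derivative makes \<open>f\<close> convex, so the one-sided first-order conditions characterise
  minimisers. Necessity looks at a small step from \<open>x\<close> towards \<open>t\<close>; sufficiency is the mean value
  theorem.
\<close>

lemma is_arg_min_iff_first_order:
  fixes f g :: "real \<Rightarrow> real"
  assumes "convex S" and der: "\<And>t. t \<in> S \<Longrightarrow> (f has_real_derivative g t) (at t within S)"
    and mono: "\<And>s t. s \<in> S \<Longrightarrow> t \<in> S \<Longrightarrow> s \<le> t \<Longrightarrow> g s \<le> g t" and "x \<in> S"
  shows "is_arg_min f (\<lambda>t. t \<in> S) x \<longleftrightarrow> (\<forall>t\<in>S. 0 \<le> g x * (t - x))"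
proof
  assume min: "is_arg_min f (\<lambda>t. t \<in> S) x"
  then have le: "f x \<le> f t" if "t \<in> S" for t
    using that by (auto simp: is_arg_min_def not_less)
  have between: "s \<in> S" if "t \<in> S" "min x t \<le> s" "s \<le> max x t" for s t
    using closed_segment_subset[OF \<open>x \<in> S\<close> that(1) \<open>convex S\<close>] that(2,3)
    by (auto simp: closed_segment_eq_real_ivl subset_iff min_def max_def split: if_splits)
  show "\<forall>t\<in>S. 0 \<le> g x * (t - x)"
  proof (rule ballI, rule ccontr)
    fix t assume "t \<in> S" and "\<not> 0 \<le> g x * (t - x)"
    then consider "g x < 0" "x < t" | "0 < g x" "t < x"
      by (auto simp: not_le mult_less_0_iff)
    then show False
    proof cases
      case 1
      then obtain d where d: "0 < d" "\<And>h. 0 < h \<Longrightarrow> x + h \<in> S \<Longrightarrow> h < d \<Longrightarrow> f (x + h) < f x"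
        using has_real_derivative_neg_dec_right[OF der[OF \<open>x \<in> S\<close>]] by blast
      define h where "h = min (d / 2) (t - x)"
      have "0 < h" "h < d" "x + h \<in> S"
        using d(1) 1 between[OF \<open>t \<in> S\<close>, of "x + h"] by (auto simp: h_def)
      then show False
        using d(2) le by fastforce
    next
      case 2
      then obtain d where d: "0 < d" "\<And>h. 0 < h \<Longrightarrow> x - h \<in> S \<Longrightarrow> h < d \<Longrightarrow> f (x - h) < f x"
        using has_real_derivative_pos_inc_left[OF der[OF \<open>x \<in> S\<close>]] by blast
      define h where "h = min (d / 2) (x - t)"
      have "0 < h" "h < d" "x - h \<in> S"
        using d(1) 2 between[OF \<open>t \<in> S\<close>, of "x - h"] by (auto simp: h_def)
      then show False
        using d(2) le by fastforce
    qed
  qed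
next
  assume fo: "\<forall>t\<in>S. 0 \<le> g x * (t - x)"
  have mvt: "\<exists>c\<in>{a..b}. c \<in> S \<and> f b - f a = g c * (b - a)" if "a \<in> S" "b \<in> S" "a \<le> b" for a b
  proof -
    have sub: "{a..b} \<subseteq> S"
      using closed_segment_subset[OF that(1,2) \<open>convex S\<close>] that(3)
      by (simp add: closed_segment_eq_real_ivl)
    have "(f has_derivative (\<lambda>h. g c * h)) (at c within {a..b})" if "a \<le> c" "c \<le> b" for c
    proof -
      have "c \<in> S"
        using sub that by auto
      then show ?thesis
        using has_derivative_subset[OF der[unfolded has_field_derivative_def] sub] by blast
    qed
    from mvt_very_simple[OF \<open>a \<le> b\<close> this] show ?thesis
      using sub by auto
  qed
  have "f x \<le> f t" if "t \<in> S" for t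
  proof (cases "x \<le> t")
    case True
    then obtain c where "c \<in> {x..t}" "c \<in> S" and eq: "f t - f x = g c * (t - x)"
      using mvt[OF \<open>x \<in> S\<close> \<open>t \<in> S\<close>] by auto
    then have "g x * (t - x) \<le> g c * (t - x)"
      using mono[OF \<open>x \<in> S\<close>] True by (intro mult_right_mono) auto
    then show ?thesis
      using eq fo that by fastforce
  next
    case False
    then obtain c where "c \<in> {t..x}" "c \<in> S" and eq: "f x - f t = g c * (x - t)"
      using mvt[OF \<open>t \<in> S\<close> \<open>x \<in> S\<close>] by auto
    then have "g c * (x - t) \<le> g x * (x - t)"
      using mono[OF _ \<open>x \<in> S\<close>] False by (intro mult_right_mono) auto
    moreover have "0 \<le> - (g x * (x - t))"
      using fo that by (auto simp: algebra_simps)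
    ultimately show ?thesis
      using eq by linarith
  qed
  then show "is_arg_min f (\<lambda>t. t \<in> S) x"
    using \<open>x \<in> S\<close> by (auto simp: is_arg_min_def not_less)
qed

text \<open>
  The variational inequality of \<open>F\<close> on a product set, in coordinates. On a product set this is
  equivalent to \<open>0 \<le> F x \<bullet> (y - x)\<close> for all profiles \<open>y\<close>; the coordinate form is the one that can
  be reweighted by a positive diagonal matrix.
\<close>

definition stationary ::
  "('n::finite \<Rightarrow> real set) \<Rightarrow> (real ^ 'n \<Rightarrow> real ^ 'n) \<Rightarrow> real ^ 'n \<Rightarrow> bool" where
  "stationary X F x \<longleftrightarrow> x \<in> profiles X \<and> (\<forall>i. \<forall>t\<in>X i. 0 \<le> F x $ i * (t - x $ i))"

lemma deviate_in_profiles: "x \<in> profiles X \<Longrightarrow> t \<in> X i \<Longrightarrow> deviate x i t \<in> profiles X"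
  by (simp add: profiles_def deviate_def)

lemma deviate_nth [simp]: "deviate x i t $ i = t"
  by (simp add: deviate_def)

lemma deviate_deviate [simp]: "deviate (deviate x i s) i t = deviate x i t"
  by (simp add: deviate_def vec_eq_iff)

lemma deviate_self [simp]: "deviate x i (x $ i) = x"
  by (simp add: deviate_def vec_eq_iff)

text \<open>
  The incentive is affine in the agent's own action with slope \<open>p\<^sub>i\<close>, so it shifts the marginal cost
  by a constant, and the one-dimensional criterion applies to each agent with the others' actions
  held at \<open>x\<close>.
\<close>

lemma is_INE_iff_stationary:
  assumes "\<And>i. convex (X i)" and pg: "partial_gradients X \<l> G"
    and mono: "\<And>x i s t. x \<in> profiles X \<Longrightarrow> s \<in> X i \<Longrightarrow> t \<in> X i \<Longrightarrow> s \<le> t \<Longrightarrow>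
      G (deviate x i s) $ i \<le> G (deviate x i t) $ i"
  shows "is_INE X \<l> xd ud p x \<longleftrightarrow> stationary X (\<lambda>x. G x + p) x"
proof (cases "x \<in> profiles X")
  case True
  have "is_arg_min (\<lambda>t. \<l> i (deviate x i t) + incentive xd ud i (deviate x i t) p)
      (\<lambda>t. t \<in> X i) (x $ i) \<longleftrightarrow> (\<forall>t\<in>X i. 0 \<le> (G x + p) $ i * (t - x $ i))" for i
  proof -
    have "((\<lambda>t. \<l> i (deviate x i t) + incentive xd ud i (deviate x i t) p) has_real_derivative
        G (deviate x i t) $ i + p $ i) (at t within X i)" if "t \<in> X i" for t
    proof -
      have "((\<lambda>s. \<l> i (deviate (deviate x i t) i s)) has_real_derivative G (deviate x i t) $ i)
          (at (deviate x i t $ i) within X i)"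
        using pg deviate_in_profiles[OF True that] unfolding partial_gradients_def by blast
      then have "((\<lambda>t. \<l> i (deviate x i t)) has_real_derivative G (deviate x i t) $ i) (at t within X i)"
        by simp
      then show ?thesis
        unfolding incentive_def by (auto intro!: derivative_eq_intros)
    qed
    moreover have "x $ i \<in> X i"
      using True by (simp add: profiles_def)
    ultimately show ?thesis
      using is_arg_min_iff_first_order[OF assms(1), of i _ "\<lambda>t. G (deviate x i t) $ i + p $ i" "x $ i"]
        mono[OF True] by simp
  qed
  then show ?thesis
    by (simp add: is_INE_def stationary_def)
qed (simp add: is_INE_def stationary_def)

section \<open>Existence and uniqueness for the variational inequality\<close>

lemma convex_profiles: "(\<And>i. convex (X i)) \<Longrightarrow> convex (profiles X)"
  by (simp add: profiles_def convex_def)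

lemma compact_profiles:
  assumes "\<And>i. compact (X i)"
  shows "compact (profiles X)"
proof -
  have "\<exists>B. \<forall>i. \<forall>t\<in>X i. \<bar>t\<bar> \<le> B i"
    using compact_imp_bounded[OF assms] by (intro choice) (auto simp: bounded_iff)
  then obtain B where B: "\<And>i t. t \<in> X i \<Longrightarrow> \<bar>t\<bar> \<le> B i"
    by blast
  have "norm x \<le> (\<Sum>i\<in>UNIV. B i)" if "x \<in> profiles X" for x
    using norm_le_l1_cart[of x] sum_mono[of UNIV "\<lambda>i. \<bar>x $ i\<bar>" B] B that
    by (force simp: profiles_def)
  then have "bounded (profiles X)"
    by (auto simp: bounded_iff)
  moreover have "closed (profiles X)"
  proof -
    have "profiles X = (\<Inter>i. (\<lambda>x. x $ i) -` X i)"
      by (auto simp: profiles_def)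
    moreover have "closed ((\<lambda>x. x $ i) -` X i)" for i
      by (intro continuous_closed_vimage compact_imp_closed assms continuous_intros)
    ultimately show ?thesis
      by auto
  qed
  ultimately show ?thesis
    by (simp add: compact_eq_bounded_closed)
qed

text \<open>
  A fixed point of the projected step \<open>\<lambda>x. closest_point (profiles X) (x - F x)\<close> exists by Brouwer's
  theorem. At such a point the obtuse angle property of the projection says that \<open>- F x\<close> makes a
  non-acute angle with every direction into the set, in particular with one agent's deviations.
\<close>

lemma stationary_exists:
  assumes "\<And>i. compact (X i)" and "\<And>i. convex (X i)" and "profiles X \<noteq> {}"
    and "continuous_on (profiles X) F"
  shows "\<exists>x. stationary X F x"
proof -
  let ?S = "profiles X"
  have S: "compact ?S" "convex ?S" "closed ?S"
    using compact_profiles[of X] convex_profiles[of X] assms(1,2) compact_imp_closed by auto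
  have "continuous_on ?S (\<lambda>x. closest_point ?S (x - F x))"
    by (rule continuous_on_compose2[OF continuous_on_closest_point[OF S(2,3) assms(3), of UNIV]])
      (auto intro!: continuous_intros assms(4))
  moreover have "(\<lambda>x. closest_point ?S (x - F x)) \<in> ?S \<rightarrow> ?S"
    using closest_point_in_set[OF S(3) assms(3)] by auto
  ultimately obtain x where x: "x \<in> ?S" "closest_point ?S (x - F x) = x"
    by (rule brouwer[OF S(1,2) assms(3)])
  have "0 \<le> F x $ i * (t - x $ i)" if "t \<in> X i" for i t
  proof -
    have "(x - F x - x) \<bullet> (deviate x i t - x) \<le> 0"
      using closest_point_dot[OF S(2,3) deviate_in_profiles[OF x(1) that], of "x - F x"] x(2) by simp
    moreover have "deviate x i t - x = axis i (t - x $ i)"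
      by (simp add: deviate_def axis_def vec_eq_iff)
    ultimately show ?thesis
      by (simp add: inner_axis)
  qed
  then show ?thesis
    using x(1) by (auto simp: stationary_def)
qed

lemma diagonal_matrix_mult_nth:
  assumes "diagonal_matrix R"
  shows "(R *v w) $ i = R $ i $ i * w $ i"
proof -
  have entry: "R $ i $ j * w $ j = (if j = i then R $ i $ i * w $ i else 0)" for j
    using assms by (auto simp: diagonal_matrix_def)
  have "(R *v w) $ i = (\<Sum>j\<in>UNIV. if j = i then R $ i $ i * w $ i else 0)"
    unfolding matrix_vector_mult_def vec_lambda_beta by (rule sum.cong[OF refl entry])
  then show ?thesis
    by simp
qed

text \<open>
  For profiles that differ in coordinate \<open>i\<close> only, the weighted monotonicity inequality has a single
  summand, and the positive weight can be cancelled.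
\<close>

lemma own_partial_mono:
  assumes "diagonal_matrix R" and "\<And>i. R $ i $ i > 0"
    and mono: "\<And>x y. x \<in> profiles X \<Longrightarrow> y \<in> profiles X \<Longrightarrow> 0 \<le> (x - y) \<bullet> (R *v (G x - G y))"
    and "x \<in> profiles X" and "s \<in> X i" and "t \<in> X i" and "s \<le> t"
  shows "G (deviate x i s) $ i \<le> G (deviate x i t) $ i"
proof (cases "s = t")
  case False
  let ?u = "deviate x i s" and ?v = "deviate x i t"
  have "?v - ?u = axis i (t - s)"
    by (simp add: deviate_def axis_def vec_eq_iff)
  then have "(?v - ?u) \<bullet> (R *v (G ?v - G ?u)) = (t - s) * (R $ i $ i * (G ?v $ i - G ?u $ i))"
    by (simp add: inner_axis' diagonal_matrix_mult_nth[OF assms(1)])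
  then have "0 \<le> (t - s) * (R $ i $ i * (G ?v $ i - G ?u $ i))"
    using mono[OF deviate_in_profiles deviate_in_profiles, OF assms(4,6,4,5)] by simp
  then show ?thesis
    using False \<open>s \<le> t\<close> assms(2)[of i] by (simp add: zero_le_mult_iff)
qed simp

text \<open>
  Adding the condition at \<open>x\<close> tested with \<open>y\<^sub>i\<close> to the condition at \<open>y\<close> tested with \<open>x\<^sub>i\<close> bounds each
  coordinate of the monotonicity expression by zero. Since the bound holds separately in each
  coordinate, it survives multiplication by positive weights.
\<close>

lemma stationary_unique:
  assumes "diagonal_matrix R" and "\<And>i. R $ i $ i > 0"
    and mono: "\<And>x y. x \<in> profiles X \<Longrightarrow> y \<in> profiles X \<Longrightarrow> x \<noteq> y \<Longrightarrow>
      0 < (x - y) \<bullet> (R *v (F x - F y))"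
    and x: "stationary X F x" and y: "stationary X F y"
  shows "x = y"
proof (rule ccontr)
  assume "x \<noteq> y"
  then have "0 < (x - y) \<bullet> (R *v (F x - F y))"
    using mono x y by (simp add: stationary_def)
  moreover have "(x - y) \<bullet> (R *v (F x - F y)) \<le> 0"
  proof -
    have "(x $ i - y $ i) * (R $ i $ i * (F x $ i - F y $ i)) \<le> 0" for i
    proof -
      have "0 \<le> F x $ i * (y $ i - x $ i)" "0 \<le> F y $ i * (x $ i - y $ i)"
        using x y by (auto simp: stationary_def profiles_def)
      then have "(F x $ i - F y $ i) * (x $ i - y $ i) \<le> 0"
        by (simp add: algebra_simps)
      then have "R $ i $ i * ((F x $ i - F y $ i) * (x $ i - y $ i)) \<le> 0"
        using assms(2)[of i] by (simp add: mult_le_0_iff)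
      then show ?thesis
        by (simp add: algebra_simps)
    qed
    then show ?thesis
      unfolding inner_vec_def by (intro sum_nonpos) (simp add: diagonal_matrix_mult_nth[OF assms(1)])
  qed
  ultimately show False
    by simp
qed

section \<open>Bounds from the matrix inequality\<close>

text \<open>
  The diagonal entries are the eigenvalues. That there are finitely many is needed for the
  maximum in \<open>lambda_max\<close> to be meaningful.
\<close>

lemma diagonal_entry_le_lambda_max:
  assumes "diagonal_matrix R"
  shows "R $ i $ i \<le> lambda_max R"
proof -
  let ?E = "{c. \<exists>v. v \<noteq> 0 \<and> R *v v = c *\<^sub>R v}"
  have "?E \<subseteq> range (\<lambda>i. R $ i $ i)"
  proof
    fix c assume "c \<in> ?E"
    then obtain v where "v \<noteq> 0" "R *v v = c *\<^sub>R v"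
      by auto
    then obtain j where "v $ j \<noteq> 0" "(R *v v) $ j = c * v $ j"
      by (auto simp: vec_eq_iff)
    then have "c = R $ j $ j"
      by (simp add: diagonal_matrix_mult_nth[OF assms])
    then show "c \<in> range (\<lambda>i. R $ i $ i)"
      by blast
  qed
  then have "finite ?E"
    by (rule finite_subset) simp
  moreover have "R *v axis i 1 = (R $ i $ i) *\<^sub>R axis i 1"
    by (simp add: vec_eq_iff diagonal_matrix_mult_nth[OF assms] axis_def)
  then have "R $ i $ i \<in> ?E"
    by (auto intro!: exI[of _ "axis i 1"] simp: axis_eq_0_iff)
  ultimately show ?thesis
    unfolding lambda_max_def by (rule Max_ge)
qed

lemma norm_diagonal_matrix_mult_le:
  assumes "diagonal_matrix R" and "\<And>i. R $ i $ i > 0"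
  shows "norm (R *v w) \<le> lambda_max R * norm w"
proof -
  have "\<bar>R $ i $ i * w $ i\<bar> \<le> \<bar>lambda_max R * w $ i\<bar>" for i
    unfolding abs_mult using diagonal_entry_le_lambda_max[OF assms(1), of i] assms(2)[of i]
    by (intro mult_right_mono) auto
  then have "norm (R *v w) \<le> norm (lambda_max R *\<^sub>R w)"
    by (intro norm_le_componentwise_cart) (simp add: diagonal_matrix_mult_nth[OF assms(1)])
  moreover have "0 \<le> lambda_max R"
    using diagonal_entry_le_lambda_max[OF assms(1)] assms(2) by (meson less_le order_trans)
  ultimately show ?thesis
    by simp
qed

lemma inner_Sym: "v \<bullet> (Sym A *v v) = v \<bullet> (A *v v)"
proof -
  have "v \<bullet> (transpose A *v v) = v \<bullet> (A *v v)"
    using dot_lmul_matrix[of v A v] by (simp add: inner_commute)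
  then show ?thesis
    by (simp add: Sym_def scaleR_matrix_vector_assoc[symmetric] matrix_vector_mult_add_rdistrib
        inner_add_right)
qed

lemma quadratic_form_ge:
  assumes "Sym A \<succeq> c *\<^sub>R mat 1"
  shows "c * (norm v)\<^sup>2 \<le> v \<bullet> (A *v v)"
proof -
  have "0 \<le> v \<bullet> ((Sym A - c *\<^sub>R mat 1) *v v)"
    using assms by (simp add: loewner_ge_def psd_def)
  also have "\<dots> = v \<bullet> (A *v v) - c * (norm v)\<^sup>2"
    by (simp add: matrix_vector_mult_diff_rdistrib inner_diff_right inner_Sym
        scaleR_matrix_vector_assoc[symmetric] power2_norm_eq_inner)
  finally show ?thesis
    by simp
qed

lemma op_norm_le: "norm (A *v v) \<le> op_norm A * norm v"
  unfolding op_norm_def by (rule onorm) simp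

text \<open>
  The sum of the absolute values of the entries dominates the operator norm and is visibly
  continuous in \<open>x\<close>.
\<close>

lemma bdd_above_op_norm_jacobian:
  fixes F :: "real ^ 'n \<Rightarrow> real ^ 'm"
  assumes "compact S" and "C_k 1 UNIV F"
  shows "bdd_above ((\<lambda>x. op_norm (jacobian F (at x))) ` S)"
proof -
  have "continuous_on S (\<lambda>x. jacobian F (at x) $ i $ j)" for i j
  proof -
    have "C_k 0 UNIV (\<lambda>x. frechet_derivative F (at x) (axis j 1))"
      using assms(2) C_k_SucD(2) by (metis One_nat_def)
    then have "continuous_on S (\<lambda>x. frechet_derivative F (at x) (axis j 1))"
      using continuous_on_subset by auto
    then show ?thesis
      unfolding jacobian_entry by (rule continuous_on_component)
  qed
  then have "continuous_on S (\<lambda>x. \<Sum>i\<in>UNIV. \<Sum>j\<in>UNIV. \<bar>jacobian F (at x) $ i $ j\<bar>)"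
    by (intro continuous_on_sum continuous_on_rabs)
  then have "bdd_above ((\<lambda>x. \<Sum>i\<in>UNIV. \<Sum>j\<in>UNIV. \<bar>jacobian F (at x) $ i $ j\<bar>) ` S)"
    by (intro bounded_imp_bdd_above compact_imp_bounded compact_continuous_image \<open>compact S\<close>)
  then obtain B where B: "\<And>x. x \<in> S \<Longrightarrow> (\<Sum>i\<in>UNIV. \<Sum>j\<in>UNIV. \<bar>jacobian F (at x) $ i $ j\<bar>) \<le> B"
    unfolding bdd_above_def by blast
  have "op_norm (jacobian F (at x)) \<le> B" if "x \<in> S" for x
    unfolding op_norm_def using onorm_le_matrix_component_sum B[OF that] by (rule order_trans)
  then show ?thesis
    by (rule bdd_aboveI2)
qed

lemma invertible_of_trivial_kernel:
  fixes A :: "real ^ 'n ^ 'n"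
  assumes "\<And>v. A *v v = 0 \<Longrightarrow> v = 0"
  shows "invertible A"
  using assms matrix_left_invertible_ker[of A] by (simp add: invertible_left_inverse)

lemma jacobian_eqI:
  fixes f :: "real ^ 'n \<Rightarrow> real ^ 'm"
  assumes "(f has_derivative (\<lambda>h. A *v h)) (at x)"
  shows "jacobian f (at x) = A"
  unfolding jacobian_def frechet_derivative_at[OF assms, symmetric]
  by (rule matrix_of_matrix_vector_mul)

lemma minus_matrix_vector_mult:
  fixes A :: "real ^ 'n ^ 'm"
  shows "(- A) *v v = - (A *v v)"
  by (simp add: vec_eq_iff matrix_vector_mult_def sum_negf)

section \<open>The response map\<close>

theorem lemma2:
  fixes d :: nat
    and e :: "'k::finite \<Rightarrow> nat ^ 'n::finite"
    and X :: "'n \<Rightarrow> real set"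
    and \<l> :: "'n \<Rightarrow> real ^ 'n \<Rightarrow> real"
    and \<Theta> :: "real ^ 'k ^ 'n"
    and xd ud :: "real ^ 'n"
    and m :: real
    and R :: "real ^ 'n ^ 'n"
  defines "\<Phi> \<equiv> monomial_vec e"
    and "G\<^sub>0 \<equiv> \<lambda>x. \<Theta> *v monomial_vec e x"
  defines "P \<equiv> (\<lambda>x. - (\<Theta> *v \<Phi> x)) ` interior (profiles X)"
    and "h\<^sub>1 \<equiv> inverse (SUP x\<in>profiles X. op_norm (jacobian G\<^sub>0 (at x)))"
    and "h\<^sub>2 \<equiv> 2 * lambda_max R / m"
  assumes "monomial_enumeration d e"
    and "\<And>i. compact (X i)" and "\<And>i. convex (X i)"
    and "partial_gradients X \<l> G\<^sub>0"
    and "xd \<in> profiles X"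
    and "m > 0"
    and "diagonal_matrix R" and "\<And>i. R $ i $ i > 0"
    and "\<And>x. x \<in> profiles X \<Longrightarrow>
           Sym (R ** \<Theta> ** jacobian \<Phi> (at x)) \<succeq> ((1 / 2) * m) *\<^sub>R mat 1"
  shows "(\<exists>!xs. response_map X \<l> xd ud xs) \<and>
    (\<forall>xs. response_map X \<l> xd ud xs \<longrightarrow>
      (\<exists>H. diffeomorphism P (interior (profiles X)) H \<and>
           (\<forall>p\<in>P. H p = xs p) \<and>
           (\<forall>p\<in>P. \<forall>w.
              h\<^sub>1 * norm w \<le> norm (jacobian H (at p) *v w) \<and>
              norm (jacobian H (at p) *v w) \<le> h\<^sub>2 * norm w \<and>
              \<Theta> *v \<Phi> (H p) + p = 0)))"
proof -
  note diag = \<open>diagonal_matrix R\<close> and pos = \<open>\<And>i. R $ i $ i > 0\<close>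
  let ?S = "profiles X" and ?J = "\<lambda>x. jacobian G\<^sub>0 (at x)"
  have cpt: "compact ?S" and cvx: "convex ?S"
    using compact_profiles convex_profiles assms(7,8) by blast+
  have C_k_G: "C_k k UNIV G\<^sub>0" for k
    unfolding G\<^sub>0_def
    by (intro C_k_bounded_linear_compose[OF matrix_vector_mul_bounded_linear] C_k_monomial_vec open_UNIV)
  have der_G: "(G\<^sub>0 has_derivative (\<lambda>h. ?J x *v h)) (at x)" for x
    using C_k_G[of 1] jacobian_works by (metis C_k.simps(2) One_nat_def UNIV_I)
  have J_eq: "?J x = \<Theta> ** jacobian \<Phi> (at x)" for x
  proof (rule jacobian_eqI)
    have "(\<Phi> has_derivative (\<lambda>h. jacobian \<Phi> (at x) *v h)) (at x)"
      using C_k_monomial_vec[OF open_UNIV, of 1 e] unfolding \<Phi>_def jacobian_works[symmetric] by simp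
    from bounded_linear.has_derivative[OF matrix_vector_mul_bounded_linear this, of \<Theta>]
    show "(G\<^sub>0 has_derivative (\<lambda>h. (\<Theta> ** jacobian \<Phi> (at x)) *v h)) (at x)"
      by (simp add: G\<^sub>0_def \<Phi>_def matrix_vector_mul_assoc)
  qed
  have coercive: "m / 2 * (norm v)\<^sup>2 \<le> v \<bullet> (R *v (?J x *v v))" if "x \<in> ?S" for x v
    using quadratic_form_ge[OF assms(14)[OF that], of v]
    by (simp add: J_eq matrix_vector_mul_assoc matrix_mul_assoc)
  have strong: "m / 2 * (norm (x - y))\<^sup>2 \<le> (x - y) \<bullet> (R *v (G\<^sub>0 x - G\<^sub>0 y))"
    if "x \<in> ?S" "y \<in> ?S" for x y
    using strongly_monotone_of_derivative[OF cvx
        bounded_linear.has_derivative[OF matrix_vector_mul_bounded_linear der_G] coercive that]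
    by (simp add: matrix_vector_mult_diff_distrib)
  then have weak: "0 \<le> (x - y) \<bullet> (R *v (G\<^sub>0 x - G\<^sub>0 y))" if "x \<in> ?S" "y \<in> ?S" for x y
    using that \<open>m > 0\<close> by (smt (verit) divide_nonneg_nonneg mult_nonneg_nonneg zero_le_power2)
  have strict: "0 < (x - y) \<bullet> (R *v ((G\<^sub>0 x + p) - (G\<^sub>0 y + p)))"
    if "x \<in> ?S" "y \<in> ?S" "x \<noteq> y" for x y p
  proof -
    have "0 < m / 2 * (norm (x - y))\<^sup>2"
      using \<open>m > 0\<close> that(3) by simp
    with strong[OF that(1,2)] show ?thesis
      by simp
  qed
  have INE: "is_INE X \<l> xd ud p x \<longleftrightarrow> stationary X (\<lambda>x. G\<^sub>0 x + p) x" for p x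
    using assms(8,9) own_partial_mono[OF diag pos weak] by (rule is_INE_iff_stationary)
  have unique: "x = y" if "is_INE X \<l> xd ud p x" "is_INE X \<l> xd ud p y" for p x y
    using stationary_unique[OF diag pos strict] that unfolding INE by blast
  have "\<exists>x. is_INE X \<l> xd ud p x" for p
    unfolding INE
  proof (rule stationary_exists)
    show "continuous_on ?S (\<lambda>x. G\<^sub>0 x + p)"
      using C_k_imp_continuous_on[OF C_k_G] by (intro continuous_intros) (blast intro: continuous_on_subset)
  qed (use assms(7,8,10) in auto)
  then have "\<exists>xs. response_map X \<l> xd ud xs"
    unfolding response_map_def by metis
  moreover have "xs = ys" if "response_map X \<l> xd ud xs" "response_map X \<l> xd ud ys" for xs ys
    using that unique unfolding response_map_def by blast
  moreover have "\<exists>H. diffeomorphism P (interior ?S) H \<and> (\<forall>p\<in>P. H p = xs p) \<and>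
      (\<forall>p\<in>P. \<forall>w. h\<^sub>1 * norm w \<le> norm (jacobian H (at p) *v w) \<and>
         norm (jacobian H (at p) *v w) \<le> h\<^sub>2 * norm w \<and> \<Theta> *v \<Phi> (H p) + p = 0)"
    if xs: "response_map X \<l> xd ud xs" for xs
  proof -
    let ?F = "\<lambda>x. - G\<^sub>0 x"
    have P_eq: "P = ?F ` interior ?S"
      by (simp add: P_def G\<^sub>0_def \<Phi>_def)
    have S: "x \<in> ?S" if "x \<in> interior ?S" for x
      using that interior_subset by blast
    \<comment> \<open>At an interior profile the incentive \<open>- G\<^sub>0 x\<close> cancels all marginal costs.\<close>
    have left_inv: "xs (?F x) = x" if "x \<in> interior ?S" for x
    proof -
      have "is_INE X \<l> xd ud (?F x) x"
        unfolding INE stationary_def using S[OF that] by simp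
      then show ?thesis
        using xs unique unfolding response_map_def by blast
    qed
    have der_F: "(?F has_derivative (\<lambda>h. (- ?J x) *v h)) (at x)" for x
      using has_derivative_minus[OF der_G] by (simp add: minus_matrix_vector_mult)
    have inv: "invertible (- ?J x)" if "x \<in> ?S" for x
    proof (rule invertible_of_trivial_kernel)
      fix v assume "- ?J x *v v = 0"
      then have "?J x *v v = 0"
        by (simp add: minus_matrix_vector_mult)
      then show "v = 0"
        using coercive[OF that, of v] \<open>m > 0\<close> by (simp add: mult_le_0_iff)
    qed
    have diffeo: "diffeomorphism P (interior ?S) xs"
      unfolding P_eq
    proof (rule diffeomorphism_of_smooth_inverse)
      have "C_k k (interior ?S) ?F" for k
        using C_k_subset[OF C_k_bounded_linear_compose[OF bounded_linear_minus[OF bounded_linear_ident] open_UNIV C_k_G]]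
        by simp
      then show "smooth_on (interior ?S) ?F"
        by (simp add: smooth_on_def)
    qed (use inv S left_inv jacobian_eqI[OF der_F] in auto)
    have bounds: "h\<^sub>1 * norm w \<le> norm (jacobian xs (at p) *v w) \<and>
         norm (jacobian xs (at p) *v w) \<le> h\<^sub>2 * norm w \<and> \<Theta> *v \<Phi> (xs p) + p = 0"
      if "p \<in> P" for p w
    proof -
      obtain x where x: "x \<in> interior ?S" "p = ?F x"
        using \<open>p \<in> P\<close> unfolding P_eq by blast
      have "(xs has_derivative (\<lambda>w. matrix_inv (jacobian ?F (at x)) *v w)) (at (?F x))"
      proof (rule has_derivative_left_inverse[where F = ?F, OF open_interior])
        show "?F differentiable (at z)" for z
          using der_F differentiable_def by blast
      qed (use inv S jacobian_eqI[OF der_F] left_inv x(1) in auto)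
      then have jac: "jacobian xs (at p) = matrix_inv (- ?J x)"
        using jacobian_eqI jacobian_eqI[OF der_F] x(2) by metis
      define u where "u = jacobian xs (at p) *v w"
      have "- ?J x *v u = w"
        unfolding u_def jac by (rule matrix_inv_mult_right[OF inv[OF S[OF x(1)]]])
      then have Ju: "?J x *v u = - w"
        by (simp add: minus_matrix_vector_mult minus_equation_iff)
      \<comment> \<open>The quadratic form is tested with \<open>u\<close>, for which \<open>?J x *v u\<close> is known.\<close>
      have "m / 2 * (norm u)\<^sup>2 \<le> norm u * (lambda_max R * norm w)"
      proof -
        have "m / 2 * (norm u)\<^sup>2 \<le> u \<bullet> (R *v (- w))"
          using coercive[OF S[OF x(1)], of u] Ju by simp
        also have "\<dots> \<le> norm u * norm (R *v (- w))"
          by (rule norm_cauchy_schwarz)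
        also have "\<dots> \<le> norm u * (lambda_max R * norm w)"
          using norm_diagonal_matrix_mult_le[OF diag pos, of "- w"] by (simp add: mult_left_mono)
        finally show ?thesis .
      qed
      then have "norm u * (m / 2 * norm u) \<le> norm u * (lambda_max R * norm w)"
        by (simp add: power2_eq_square algebra_simps)
      moreover have "0 \<le> lambda_max R"
        using diagonal_entry_le_lambda_max[OF diag] pos by (meson less_le order_trans)
      ultimately have "m / 2 * norm u \<le> lambda_max R * norm w"
        by (cases "norm u = 0") simp_all
      then have upper: "norm u \<le> h\<^sub>2 * norm w"
        using \<open>m > 0\<close> by (simp add: h\<^sub>2_def field_simps)
      let ?M = "SUP x\<in>?S. op_norm (?J x)"
      have "norm w = norm (?J x *v u)"
        using Ju by simp
      also have "\<dots> \<le> op_norm (?J x) * norm u"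
        by (rule op_norm_le)
      also have "\<dots> \<le> ?M * norm u"
        using bdd_above_op_norm_jacobian[OF cpt C_k_G] S[OF x(1)]
        by (intro mult_right_mono cSUP_upper) auto
      finally have M: "norm w \<le> ?M * norm u" .
      \<comment> \<open>A vanishing supremum is covered by the convention \<open>inverse 0 = 0\<close>.\<close>
      have lower: "h\<^sub>1 * norm w \<le> norm u"
      proof (cases "?M > 0")
        case True
        then show ?thesis
          using M by (simp add: h\<^sub>1_def field_simps)
      next
        case False
        then have "h\<^sub>1 \<le> 0"
          by (simp add: h\<^sub>1_def)
        then have "h\<^sub>1 * norm w \<le> 0"
          by (simp add: mult_nonpos_nonneg)
        then show ?thesis
          using norm_ge_zero[of u] by linarith
      qed
      have "\<Theta> *v \<Phi> (xs p) + p = 0"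
        using left_inv[OF x(1)] x(2) by (simp add: G\<^sub>0_def \<Phi>_def)
      with lower upper show ?thesis
        by (simp add: u_def)
    qed
    show ?thesis
      using diffeo bounds by blast
  qed
  ultimately show ?thesis
    by blast
qed

end
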